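(* Let $G$ be a weighted graph. (a) If $a\in V(G)$ is unlooped then $q(G)-\beta(a)q(G-a)=q(G^{a})-\beta(a)q(G^{a}-a)$. (b) If $a,b\in V(G)$ are distinct adjacent unlooped vertices then $q(G-a)-\beta(a)q(G-a-b)=q(G^{ab}-a)-\beta(a)q(G^{ab}-a-b)$. (c) If $G$ is the union of disjoint subgraphs $G_1$ and $G_2$ (with no edges between them) then $q(G)=q(G_1)q(G_2)$.
   Context: All graphs are finite and may have loops (at most one per vertex) but no multiple edges. The adjacency matrix of a graph is the symmetric $0/1$ matrix over $GF(2)$ whose diagonal entry at $v$ is $1$ iff $v$ is looped; $r(G)$, $n(G)$ are its rank and nullity over $GF(2)$ (empty graph: $r=n=0$). For $S\subseteq V(G)$, $G[S]$ is the induced subgraph. Let $A$ be a commutative ring with unity containing elements $x,y$. A weighted graph is a graph $G$ with functions $\alpha,\beta:V(G)\to A$, and \[ q(G)=\sum_{S\subseteq V(G)}\Big(\prod_{s\in S}\alpha(s)\Big)\Big(\prod_{v\notin S}\beta(v)\Big)(x-1)^{r(G[S])}(y-1)^{n(G[S])}. \] Graph operations keep vertex weights. Local complement $G^a$: toggle the adjacency $\{u,w\}$ for all neighbors $u,w$ of $a$ distinct from $a$, including $u=w$. Pivot $G^{ab}$ ($a\ne b$): toggle $\{u,w\}$ for all $u,w\notin\{a,b\}$ with $u$ adjacent to $a$, $w$ adjacent to $b$, and either $u$ not adjacent to $b$ or $w$ not adjacent to $a$.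
   Formalization: In (b) the coefficient β(a) is replaced by β(b) on both sides; as printed, (b) fails for the unlooped path u–a–b–w with α=1, β(a)=0, β(b)=1, x=1, y=2, and the corrected identity implies the printed one whenever that holds. *)

theory Defs
  imports Complex_Main "HOL-Library.Z2" "HOL-Library.Function_Algebras"
begin

text \<open>
  Edges are vertex sets: a loop at \<open>v\<close> is the singleton \<open>{v} = {v, v}\<close>. Vertex weights are total
  functions, but only their values on \<open>verts G\<close> are ever used.
\<close>

record ('v, 'a) wgraph =
  verts :: "'v set"
  edges :: "'v set set"
  alpha :: "'v \<Rightarrow> 'a"
  beta :: "'v \<Rightarrow> 'a"

definition weighted_graph :: "('v, 'a) wgraph \<Rightarrow> bool" where
  "weighted_graph G \<longleftrightarrow>
     finite (verts G) \<and> edges G \<subseteq> {{u, v} | u v. u \<in> verts G \<and> v \<in> verts G}"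

definition adjacent :: "('v, 'a) wgraph \<Rightarrow> 'v \<Rightarrow> 'v \<Rightarrow> bool" where
  "adjacent G u v \<longleftrightarrow> {u, v} \<in> edges G"

definition looped :: "('v, 'a) wgraph \<Rightarrow> 'v \<Rightarrow> bool" where
  "looped G v \<longleftrightarrow> {v} \<in> edges G"

definition induced :: "('v, 'a) wgraph \<Rightarrow> 'v set \<Rightarrow> ('v, 'a) wgraph" where
  "induced G S = G\<lparr>verts := verts G \<inter> S, edges := {e \<in> edges G. e \<subseteq> S}\<rparr>"

definition delete_vertex :: "('v, 'a) wgraph \<Rightarrow> 'v \<Rightarrow> ('v, 'a) wgraph" where
  "delete_vertex G a = induced G (verts G - {a})"

text \<open>
  Vectors over GF(2) are functions into \<^typ>\<open>bit\<close> with pointwise operations; those indexed by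
  \<open>verts G\<close> are the functions vanishing outside \<open>verts G\<close>.
\<close>

definition gf2_scale :: "bit \<Rightarrow> ('v \<Rightarrow> bit) \<Rightarrow> 'v \<Rightarrow> bit" where
  "gf2_scale c f = (\<lambda>v. c * f v)"

interpretation gf2: vector_space "gf2_scale :: bit \<Rightarrow> ('v \<Rightarrow> bit) \<Rightarrow> 'v \<Rightarrow> bit"
  by unfold_locales (auto simp: gf2_scale_def fun_eq_iff)

text \<open>
  The rows and columns of the adjacency matrix are indexed by \<open>verts G\<close>; for a
  \<^const>\<open>weighted_graph\<close> all entries outside \<open>verts G\<close> are zero.
\<close>

definition adj_matrix :: "('v, 'a) wgraph \<Rightarrow> 'v \<Rightarrow> 'v \<Rightarrow> bit" where
  "adj_matrix G u v = (if adjacent G u v then 1 else 0)"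

definition graph_rank :: "('v, 'a) wgraph \<Rightarrow> nat" where
  "graph_rank G = gf2.dim ((\<lambda>u. adj_matrix G u) ` verts G)"

definition graph_nullity :: "('v, 'a) wgraph \<Rightarrow> nat" where
  "graph_nullity G =
     gf2.dim {f. (\<forall>v. v \<notin> verts G \<longrightarrow> f v = 0) \<and>
                 (\<forall>u\<in>verts G. (\<Sum>v\<in>verts G. adj_matrix G u v * f v) = 0)}"

definition interlace :: "'a::comm_ring_1 \<Rightarrow> 'a \<Rightarrow> ('v, 'a) wgraph \<Rightarrow> 'a" where
  "interlace x y G =
     (\<Sum>S\<in>Pow (verts G). (\<Prod>s\<in>S. alpha G s) * (\<Prod>v\<in>verts G - S. beta G v) *
        (x - 1) ^ graph_rank (induced G S) * (y - 1) ^ graph_nullity (induced G S))"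

text \<open>In \<open>local_complement\<close> the case \<open>u = w\<close> toggles the loop at \<open>u\<close>.\<close>

definition local_complement :: "('v, 'a) wgraph \<Rightarrow> 'v \<Rightarrow> ('v, 'a) wgraph" where
  "local_complement G a =
     G\<lparr>edges := sym_diff (edges G)
        {{u, w} | u w. u \<noteq> a \<and> w \<noteq> a \<and> adjacent G u a \<and> adjacent G w a}\<rparr>"

definition pivot :: "('v, 'a) wgraph \<Rightarrow> 'v \<Rightarrow> 'v \<Rightarrow> ('v, 'a) wgraph" where
  "pivot G a b =
     G\<lparr>edges := sym_diff (edges G)
        {{u, w} | u w. u \<notin> {a, b} \<and> w \<notin> {a, b} \<and> adjacent G u a \<and> adjacent G w b \<and>
                       (\<not> adjacent G u b \<or> \<not> adjacent G w a)}\<rparr>"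

definition weighted_subgraph :: "('v, 'a) wgraph \<Rightarrow> ('v, 'a) wgraph \<Rightarrow> bool" where
  "weighted_subgraph H G \<longleftrightarrow>
     weighted_graph H \<and> verts H \<subseteq> verts G \<and> edges H \<subseteq> edges G \<and>
     (\<forall>v\<in>verts H. alpha H v = alpha G v \<and> beta H v = beta G v)"

definition disjoint_union :: "('v, 'a) wgraph \<Rightarrow> ('v, 'a) wgraph \<Rightarrow> ('v, 'a) wgraph \<Rightarrow> bool" where
  "disjoint_union G G1 G2 \<longleftrightarrow>
     weighted_subgraph G1 G \<and> weighted_subgraph G2 G \<and> verts G1 \<inter> verts G2 = {} \<and>
     verts G = verts G1 \<union> verts G2 \<and> edges G = edges G1 \<union> edges G2"

end

theory Submission
  imports Defs
begin

text \<open>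
  Both sides of the first two identities are sums over the vertex sets \<open>S\<close> containing one
  fixed vertex \<open>c\<close> (\<open>c = a\<close> for the local complement, \<open>c = b\<close> for the pivot after deletion of \<open>a\<close>),
  and they agree term by term. Indeed, as \<open>c\<close> is unlooped, the adjacency matrix of \<open>G\<^sup>a[S]\<close> arises
  from that of \<open>G[S]\<close> by adding row \<open>a\<close> to the rows of its neighbours; that of \<open>G\<^sup>a\<^sup>b[S]\<close> arises
  by adding row \<open>b\<close> to the rows of the neighbours of \<open>a\<close> and then performing the same operation on
  columns. Hence rank and nullity do not change. For disjoint unions rank and
  nullity are additive.
\<close>

section \<open>Dimension\<close>

text \<open>A basis of \<open>V\<close> is mapped to an independent set, because \<open>f\<close> is
  injective on the span, and the images span the image of \<open>V\<close>. Injectivity keeps the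
  cardinality.\<close>

lemma (in vector_space_pair) dim_image_inj:
  assumes "Vector_Spaces.linear s1 s2 f" "inj_on f (vs1.span V)"
  shows "vs2.dim (f ` V) = vs1.dim V"
proof -
  obtain B where B: "B \<subseteq> V" "vs1.independent B" "V \<subseteq> vs1.span B" "card B = vs1.dim V"
    using vs1.basis_exists by blast
  have spanB: "vs1.span B = vs1.span V"
    using B by (metis vs1.span_mono vs1.span_span subset_antisym)
  have "vs2.independent (f ` B)"
    using linear_independent_injective_image[OF assms(1) B(2)] assms(2) spanB by simp
  moreover have "vs2.span (f ` B) = vs2.span (f ` V)"
    using linear_span_image[OF assms(1)] spanB by simp
  ultimately have "vs2.dim (f ` V) = card (f ` B)"
    by (metis vs2.dim_eq_card)
  also have "\<dots> = card B"
    by (intro card_image inj_on_subset[OF assms(2)]) (use B(1) vs1.span_superset in blast)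
  finally show ?thesis
    using B(4) by simp
qed

context vector_space
begin

text \<open>If \<open>a\<close> in \<open>B\<close> were \<open>x + y\<close> with \<open>x\<close>
  in the span of \<open>B - {a}\<close> and \<open>y\<close> in that of \<open>C\<close>, then
  \<open>y = a - x\<close> would lie in both spans and vanish, contradicting independence of
  \<open>B\<close>. \<open>aux\<close> keeps \<open>B\<close> and \<open>C\<close> general so that
  it also covers \<open>a\<close> in \<open>C\<close>.\<close>

lemma independent_Un:
  assumes "independent B" "independent C" "span B \<inter> span C \<subseteq> {0}"
  shows "independent (B \<union> C)"
proof -
  have aux: "a \<notin> span (B \<union> C - {a})"
    if a: "a \<in> B" and ind: "independent B" and disj: "span B \<inter> span C \<subseteq> {0}" for a B C
  proof
    assume "a \<in> span (B \<union> C - {a})"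
    also have "\<dots> \<subseteq> span ((B - {a}) \<union> C)"
      by (intro span_mono) auto
    finally obtain x y where xy: "a = x + y" "x \<in> span (B - {a})" "y \<in> span C"
      by (auto simp: span_Un)
    have "x \<in> span B"
      using xy(2) span_mono[of "B - {a}" B] by auto
    hence "y \<in> span B"
      using xy(1) a by (metis add_diff_cancel_left' span_base span_diff)
    hence "a \<in> span (B - {a})"
      using xy disj by auto
    thus False
      using a ind by (auto simp: dependent_def)
  qed
  show ?thesis
    unfolding dependent_def
    using aux[of _ B C] aux[of _ C B] assms by (auto simp: Un_commute Int_commute)
qed

text \<open>Bases of \<open>U\<close> and \<open>V\<close> are disjoint, since a common element
  would be 0, and their union is a basis for \<open>U \<union> V\<close>.\<close>

lemma dim_Un:
  assumes "finite U" "finite V" "span U \<inter> span V \<subseteq> {0}"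
  shows "dim (U \<union> V) = dim U + dim V"
proof -
  obtain B where B: "B \<subseteq> U" "independent B" "U \<subseteq> span B" "card B = dim U"
    using basis_exists by blast
  obtain C where C: "C \<subseteq> V" "independent C" "V \<subseteq> span C" "card C = dim V"
    using basis_exists by blast
  have disj: "span B \<inter> span C \<subseteq> {0}"
    using assms(3) span_mono[OF B(1)] span_mono[OF C(1)] by blast
  have "B \<inter> C = {}"
  proof -
    have "0 \<notin> B"
      using B(2) dependent_zero by blast
    thus ?thesis
      using disj span_superset[of B] span_superset[of C] by blast
  qed
  moreover have "finite B" "finite C"
    using B(1) C(1) assms by (auto intro: finite_subset)
  ultimately have "card (B \<union> C) = dim U + dim V"
    using B C by (simp add: card_Un_disjoint)
  moreover have "card (B \<union> C) = dim (U \<union> V)"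
  proof (rule basis_card_eq_dim)
    show "B \<union> C \<subseteq> U \<union> V"
      using B(1) C(1) by blast
    show "independent (B \<union> C)"
      by (rule independent_Un[OF B(2) C(2) disj])
    show "U \<union> V \<subseteq> span (B \<union> C)"
      using B(3) C(3) span_mono[of B "B \<union> C"] span_mono[of C "B \<union> C"] by blast
  qed
  ultimately show ?thesis
    by simp
qed

end

lemma gf2_dim_image_involution:
  assumes "\<And>f g. T (f + g) = T f + T g" "\<And>c f. T (gf2_scale c f) = gf2_scale c (T f)"
    and "\<And>f. T (T f) = f"
  shows "gf2.dim (T ` V) = gf2.dim V"
proof -
  interpret P: vector_space_pair "gf2_scale :: bit \<Rightarrow> ('b \<Rightarrow> bit) \<Rightarrow> _"
    "gf2_scale :: bit \<Rightarrow> ('a \<Rightarrow> bit) \<Rightarrow> _" ..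
  have "Vector_Spaces.linear gf2_scale gf2_scale T"
    by unfold_locales (use assms in auto)
  moreover have "inj_on T X" for X
    using assms(3) by (metis inj_onI)
  ultimately show ?thesis
    by (rule P.dim_image_inj)
qed

section \<open>Row and column operations over GF(2)\<close>

text \<open>Null space of an arbitrary square matrix indexed by \<open>S\<close>: the intermediate
  matrices of row and column operations need not be symmetric, hence need not come from a
  graph.\<close>

definition kernel_on :: "'v set \<Rightarrow> ('v \<Rightarrow> 'v \<Rightarrow> bit) \<Rightarrow> ('v \<Rightarrow> bit) set" where
  "kernel_on S M =
     {f. (\<forall>v. v \<notin> S \<longrightarrow> f v = 0) \<and> (\<forall>u\<in>S. (\<Sum>v\<in>S. M u v * f v) = 0)}"

lemma graph_nullity_kernel_on: "graph_nullity G = gf2.dim (kernel_on (verts G) (adj_matrix G))"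
  by (simp add: graph_nullity_def kernel_on_def)

text \<open>Finiteness of the field makes null spaces finite sets, as \<open>dim_Un\<close>
  requires.\<close>

lemma finite_kernel_on:
  assumes "finite S"
  shows "finite (kernel_on S M)"
proof (rule finite_subset)
  show "kernel_on S M \<subseteq> {f. \<forall>v. (v \<in> S \<longrightarrow> f v \<in> {0, 1}) \<and> (v \<notin> S \<longrightarrow> f v = 0)}"
    by (auto simp: kernel_on_def)
  show "finite {f. \<forall>v. (v \<in> S \<longrightarrow> f v \<in> {0, 1 :: bit}) \<and> (v \<notin> S \<longrightarrow> f v = 0)}"
    by (rule finite_set_of_finite_funs) (use assms in auto)
qed

lemma bit_add_self: "(x::bit) + x = 0"
  by (cases x) auto

lemma bit_add_self_left: "(x::bit) + (x + y) = y"
  by (cases x; cases y) auto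

text \<open>Ring normalisation in characteristic 2. The proofs below delete
  \<open>add_bit_eq_xor\<close> and \<open>mult_bit_eq_and\<close>, which would turn ring arithmetic
  into Boolean operations.\<close>

lemmas bit_ring_simps = bit_add_self bit_add_self_left add_ac mult_ac distrib_left distrib_right

text \<open>The vector \<open>c\<close> selects the rows (or columns) to which row (or column)
  \<open>a\<close> is added. Since \<open>c a = 0\<close>, row (column) \<open>a\<close> itself
  stays fixed, so over GF(2) the operation is its own inverse.\<close>

context
  fixes S :: "'v set" and M M' :: "'v \<Rightarrow> 'v \<Rightarrow> bit" and c :: "'v \<Rightarrow> bit" and a :: 'v
  assumes aS: "a \<in> S" and ca: "c a = 0"
begin

context
  assumes row_op: "\<And>u w. u \<in> S \<Longrightarrow> M' u w = M u w + c u * M a w"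
begin

lemma dim_row_op: "gf2.dim (M' ` S) = gf2.dim (M ` S)"
proof (rule gf2.span_eq_dim)
  have eq: "M' u = M u + gf2_scale (c u) (M a)" if "u \<in> S" for u
    using row_op[OF that] by (auto simp: gf2_scale_def simp del: add_bit_eq_xor mult_bit_eq_and)
  have M'a: "M' a = M a"
    using row_op[OF aS] ca by auto
  have eq': "M u = M' u + gf2_scale (c u) (M' a)" if "u \<in> S" for u
    unfolding M'a eq[OF that]
    by (auto simp: gf2_scale_def bit_ring_simps simp del: add_bit_eq_xor mult_bit_eq_and)
  have "M' u \<in> gf2.span (M ` S)" if "u \<in> S" for u
    unfolding eq[OF that] using that aS
    by (intro gf2.span_add gf2.span_scale gf2.span_base) auto
  moreover have "M u \<in> gf2.span (M' ` S)" if "u \<in> S" for u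
    by (subst eq'[OF that], use that aS in \<open>intro gf2.span_add gf2.span_scale gf2.span_base\<close>) auto
  ultimately show "gf2.span (M' ` S) = gf2.span (M ` S)"
    by (subst gf2.span_eq) auto
qed

text \<open>Equation \<open>u\<close> of the new system is equation \<open>u\<close> of the old one
  plus \<open>c u\<close> times equation \<open>a\<close>, and equation \<open>a\<close> belongs to
  both systems.\<close>

lemma kernel_on_row_op: "kernel_on S M' = kernel_on S M"
proof -
  have eq: "(\<Sum>v\<in>S. M' u v * f v) = (\<Sum>v\<in>S. M u v * f v) + c u * (\<Sum>v\<in>S. M a v * f v)"
    if "u \<in> S" for u f
    using row_op[OF that]
    by (simp add: sum_distrib_left sum.distrib [symmetric] distrib_left distrib_right mult_ac
             del: add_bit_eq_xor mult_bit_eq_and)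
  have "(\<Sum>v\<in>S. M' a v * f v) = (\<Sum>v\<in>S. M a v * f v)" for f
    using eq[OF aS, of f] ca by simp
  hence "(\<forall>u\<in>S. (\<Sum>v\<in>S. M' u v * f v) = 0) \<longleftrightarrow> (\<forall>u\<in>S. (\<Sum>v\<in>S. M u v * f v) = 0)" for f
    using eq[of _ f] aS by (metis add_0_right mult_zero_right)
  thus ?thesis
    by (simp add: kernel_on_def)
qed

end

context
  assumes col_op: "\<And>u w. u \<in> S \<Longrightarrow> M' u w = M u w + M u a * c w"
begin

lemma dim_col_op: "gf2.dim (M' ` S) = gf2.dim (M ` S)"
proof -
  \<comment> \<open>A column operation acts on each row separately, by this linear map. From
    \<open>c a = 0\<close> follows \<open>T f a = f a\<close>, so \<open>T\<close> is an
    involution.\<close>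
  define T where "T f = (\<lambda>w. f w + f a * c w)" for f :: "'v \<Rightarrow> bit"
  have "gf2.dim (T ` M ` S) = gf2.dim (M ` S)"
    by (rule gf2_dim_image_involution)
      (auto simp: T_def fun_eq_iff gf2_scale_def ca bit_ring_simps
            simp del: add_bit_eq_xor mult_bit_eq_and)
  moreover have "T ` M ` S = M' ` S"
    unfolding image_image T_def
    by (intro image_cong) (auto simp: col_op fun_eq_iff)
  ultimately show ?thesis
    by simp
qed

text \<open>With \<open>e_a\<close> the unit vector at \<open>a\<close>, the operation is
  \<open>M' = M E\<close> for \<open>E = I + e_a c^T\<close>. The null space may change, but
  \<open>E\<close> maps that of \<open>M'\<close> isomorphically onto that of
  \<open>M\<close>.\<close>

lemma dim_kernel_on_col_op:
  assumes "finite S"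
  shows "gf2.dim (kernel_on S M') = gf2.dim (kernel_on S M)"
proof -
  define l where "l f = (\<Sum>w\<in>S. c w * f w)" for f
  \<comment> \<open>This is \<open>E\<close> acting on column vectors: the product
    \<open>l f\<close> of \<open>c\<close> and \<open>f\<close> is added in coordinate
    \<open>a\<close>.\<close>
  define T where "T f = (\<lambda>v. f v + (if v = a then l f else 0))" for f :: "'v \<Rightarrow> bit"
  \<comment> \<open>Taking \<open>h = c\<close> shows that \<open>l\<close> is invariant under
    \<open>T\<close>, so \<open>T\<close> is an involution; taking \<open>h = M u\<close> gives row
    \<open>u\<close> of \<open>M (T f) = M' f\<close>.\<close>
  have sum_T: "(\<Sum>v\<in>S. h v * T f v) = (\<Sum>v\<in>S. h v * f v) + h a * l f" for h f
  proof -
    have "(\<Sum>v\<in>S. h v * T f v) = (\<Sum>v\<in>S. h v * f v + (if v = a then h a * l f else 0))"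
      by (intro sum.cong) (auto simp: T_def distrib_left simp del: add_bit_eq_xor mult_bit_eq_and)
    thus ?thesis
      using aS assms by (simp add: sum.distrib del: add_bit_eq_xor mult_bit_eq_and)
  qed
  have l_T: "l (T f) = l f" for f
    using sum_T[of c f] ca by (simp add: l_def)
  have T_T: "T (T f) = f" for f
    using l_T[of f] by (auto simp: T_def fun_eq_iff bit_ring_simps simp del: add_bit_eq_xor)
  have sum_M: "(\<Sum>v\<in>S. M u v * T f v) = (\<Sum>v\<in>S. M' u v * f v)" if "u \<in> S" for u f
    unfolding sum_T l_def using col_op[OF that]
    by (simp add: sum_distrib_left sum.distrib [symmetric] distrib_left distrib_right mult_ac
             del: add_bit_eq_xor mult_bit_eq_and)
  have T_outside: "T f v = f v" if "v \<notin> S" for f v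
    using that aS by (auto simp: T_def)
  have iff: "f \<in> kernel_on S M' \<longleftrightarrow> T f \<in> kernel_on S M" for f
    unfolding kernel_on_def mem_Collect_eq
    by (intro arg_cong2[of _ _ _ _ "(\<and>)"] all_cong ball_cong refl) (simp_all only: T_outside sum_M not_False_eq_True)
  have "T ` kernel_on S M' = kernel_on S M"
  proof (intro subset_antisym subsetI)
    show "f \<in> kernel_on S M" if "f \<in> T ` kernel_on S M'" for f
      using that iff by blast
    show "f \<in> T ` kernel_on S M'" if "f \<in> kernel_on S M" for f
      using that iff[of "T f"] T_T[of f] by (intro image_eqI[of _ _ "T f"]) simp_all
  qed
  moreover have "gf2.dim (T ` kernel_on S M') = gf2.dim (kernel_on S M')"
  proof (rule gf2_dim_image_involution)
    have "l (f + g) = l f + l g" for f g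
      by (simp add: l_def distrib_left sum.distrib del: add_bit_eq_xor mult_bit_eq_and)
    thus "T (f + g) = T f + T g" for f g
      by (simp add: T_def fun_eq_iff add_ac del: add_bit_eq_xor)
    have "l (gf2_scale k f) = k * l f" for k f
      by (simp add: l_def gf2_scale_def sum_distrib_left mult.left_commute del: mult_bit_eq_and)
    thus "T (gf2_scale k f) = gf2_scale k (T f)" for k f
      by (simp add: T_def fun_eq_iff gf2_scale_def distrib_left del: add_bit_eq_xor mult_bit_eq_and)
  qed (rule T_T)
  ultimately show ?thesis
    by simp
qed

end

end

lemma dim_symmetric_op:
  fixes M M' :: "'v \<Rightarrow> 'v \<Rightarrow> bit"
  assumes "finite S" "b \<in> S" "c b = 0" "M b b = 0"
    and M': "\<And>u w. u \<in> S \<Longrightarrow> M' u w = M u w + c u * M b w + M u b * c w"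
  shows "gf2.dim (M' ` S) = gf2.dim (M ` S)"
    and "gf2.dim (kernel_on S M') = gf2.dim (kernel_on S M)"
proof -
  \<comment> \<open>\<open>X\<close> is the matrix after the row operation. As
    \<open>M b b = 0\<close>, its column \<open>b\<close> is still that of \<open>M\<close>, so the
    remaining summand \<open>M u b * c w\<close> is a column operation on \<open>X\<close>.\<close>
  define X where "X u w = M u w + c u * M b w" for u w
  have X: "M' u w = X u w + X u b * c w" if "u \<in> S" for u w
    using M'[OF that] assms(4) by (simp add: X_def del: add_bit_eq_xor mult_bit_eq_and)
  show "gf2.dim (M' ` S) = gf2.dim (M ` S)"
    using dim_col_op[where c = c, OF assms(2,3), of M' X] dim_row_op[where c = c, OF assms(2,3), of X M] X
    by (simp add: X_def)
  show "gf2.dim (kernel_on S M') = gf2.dim (kernel_on S M)"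
    using dim_kernel_on_col_op[where c = c, OF assms(2,3), of M' X]
      kernel_on_row_op[where c = c, OF assms(2,3), of X M] X
      assms(1)
    by (simp add: X_def)
qed

section \<open>Graph operations\<close>

lemma adjacent_commute: "adjacent G u v \<longleftrightarrow> adjacent G v u"
  by (simp add: adjacent_def insert_commute)

lemma adjacent_self: "adjacent G u u \<longleftrightarrow> looped G u"
  by (simp add: adjacent_def looped_def)

lemma induced_sel [simp]:
  "verts (induced G S) = verts G \<inter> S" "alpha (induced G S) = alpha G" "beta (induced G S) = beta G"
  by (simp_all add: induced_def)

lemma adjacent_induced: "adjacent (induced G S) u w \<longleftrightarrow> adjacent G u w \<and> u \<in> S \<and> w \<in> S"
  by (auto simp: adjacent_def induced_def)

lemma induced_induced: "S \<subseteq> T \<Longrightarrow> induced (induced G T) S = induced G S"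
proof -
  assume "S \<subseteq> T"
  hence "verts G \<inter> T \<inter> S = verts G \<inter> S"
    "{e \<in> {e \<in> edges G. e \<subseteq> T}. e \<subseteq> S} = {e \<in> edges G. e \<subseteq> S}"
    by auto
  thus ?thesis
    by (simp add: induced_def)
qed

lemma verts_delete_vertex [simp]: "verts (delete_vertex G a) = verts G - {a}"
  by (auto simp: delete_vertex_def)

lemma weights_delete_vertex [simp]:
  "alpha (delete_vertex G a) = alpha G" "beta (delete_vertex G a) = beta G"
  by (simp_all add: delete_vertex_def)

lemma induced_delete_vertex: "S \<subseteq> verts G - {a} \<Longrightarrow> induced (delete_vertex G a) S = induced G S"
  by (simp add: delete_vertex_def induced_induced)

lemma local_complement_sel [simp]:
  "verts (local_complement G a) = verts G" "alpha (local_complement G a) = alpha G"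
  "beta (local_complement G a) = beta G"
  by (simp_all add: local_complement_def)

lemma adjacent_local_complement:
  "adjacent (local_complement G a) u w \<longleftrightarrow>
     adjacent G u w \<noteq> (u \<noteq> a \<and> w \<noteq> a \<and> adjacent G u a \<and> adjacent G w a)"
  by (auto simp: adjacent_def local_complement_def doubleton_eq_iff)

lemma pivot_sel [simp]:
  "verts (pivot G a b) = verts G" "alpha (pivot G a b) = alpha G" "beta (pivot G a b) = beta G"
  by (simp_all add: pivot_def)

text \<open>The definition toggles unordered pairs, so its condition may hold for
  \<open>u, w\<close> in either order. With P for \<open>u\<close> adjacent to \<open>a\<close> and
  \<open>w\<close> to \<open>b\<close>, and Q for the same with \<open>u, w\<close> exchanged, this
  is (P and not Q) or (Q and not P): an exclusive or, that is, a sum over GF(2).\<close>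

lemma adjacent_pivot:
  "adjacent (pivot G a b) u w \<longleftrightarrow>
     adjacent G u w \<noteq> (u \<notin> {a, b} \<and> w \<notin> {a, b} \<and>
       (adjacent G u a \<and> adjacent G w b) \<noteq> (adjacent G w a \<and> adjacent G u b))"
  by (auto simp: adjacent_def pivot_def doubleton_eq_iff)

section \<open>Rank and nullity of induced subgraphs under the graph operations\<close>

lemma induced_local_complement_rank_nullity:
  assumes "a \<in> S" "S \<subseteq> verts G" "\<not> looped G a"
  shows "graph_rank (induced (local_complement G a) S) = graph_rank (induced G S)"
    and "graph_nullity (induced (local_complement G a) S) = graph_nullity (induced G S)"
proof -
  let ?M = "adj_matrix (induced G S)" and ?M' = "adj_matrix (induced (local_complement G a) S)"
  have S: "verts G \<inter> S = S"
    using assms(2) by auto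
  \<comment> \<open>The product is 1 exactly when \<open>u\<close> and \<open>w\<close> are both
    neighbours of \<open>a\<close> in \<open>S\<close>; as \<open>a\<close> is unlooped, it vanishes
    for \<open>u = a\<close> or \<open>w = a\<close>. Thus column \<open>a\<close> of
    \<open>?M\<close> serves as the coefficient vector of a row operation.\<close>
  have M': "?M' u w = ?M u w + ?M u a * ?M a w" for u w
    using assms(1,3) adjacent_commute[of G a u] adjacent_commute[of G a w]
    by (auto simp: adj_matrix_def adjacent_induced adjacent_local_complement adjacent_self[of G])
  have "?M a a = 0"
    using assms(3) by (simp add: adj_matrix_def adjacent_induced adjacent_self[of G])
  note dim_row_op[where M' = ?M' and M = ?M and c = "\<lambda>u. ?M u a", OF assms(1) this M']
    and kernel_on_row_op[where M' = ?M' and M = ?M and c = "\<lambda>u. ?M u a", OF assms(1) this M']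
  thus "graph_rank (induced (local_complement G a) S) = graph_rank (induced G S)"
    "graph_nullity (induced (local_complement G a) S) = graph_nullity (induced G S)"
    by (simp_all add: graph_rank_def graph_nullity_kernel_on S)
qed

lemma induced_pivot_rank_nullity:
  assumes "finite S" "b \<in> S" "a \<notin> S" "S \<subseteq> verts G" "\<not> looped G b"
  shows "graph_rank (induced (pivot G a b) S) = graph_rank (induced G S)"
    and "graph_nullity (induced (pivot G a b) S) = graph_nullity (induced G S)"
proof -
  let ?M = "adj_matrix (induced G S)" and ?M' = "adj_matrix (induced (pivot G a b) S)"
  \<comment> \<open>Since \<open>a\<close> lies outside \<open>S\<close>, its adjacencies are not a
    row of \<open>?M\<close> and enter as a separate vector. Excluding \<open>b\<close> gives
    \<open>c b = 0\<close>.\<close>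
  define c where "c u = (if u \<in> S \<and> u \<noteq> b \<and> adjacent G u a then 1 else 0 :: bit)" for u
  have S: "verts G \<inter> S = S"
    using assms(4) by auto
  have M': "?M' u w = ?M u w + c u * ?M b w + ?M u b * c w" for u w
    using assms(2,3,5) adjacent_commute[of G b u] adjacent_commute[of G b w]
    by (auto simp: adj_matrix_def c_def adjacent_induced adjacent_pivot adjacent_self[of G])
  have "c b = 0" "?M b b = 0"
    using assms(5) by (simp_all add: c_def adj_matrix_def adjacent_induced adjacent_self[of G])
  from dim_symmetric_op[where M' = ?M', OF assms(1,2) this M']
  show "graph_rank (induced (pivot G a b) S) = graph_rank (induced G S)"
    "graph_nullity (induced (pivot G a b) S) = graph_nullity (induced G S)"
    by (simp_all add: graph_rank_def graph_nullity_kernel_on S)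
qed

text \<open>The matrix is block diagonal. Rows of different blocks, and likewise null vectors of
  different blocks, have disjoint supports, so their spans meet only in 0 and \<open>dim_Un\<close>
  applies.\<close>

lemma disjoint_union_rank_nullity:
  assumes U: "disjoint_union G G1 G2" and fin: "finite (verts G)"
    and S: "S1 \<subseteq> verts G1" "S2 \<subseteq> verts G2"
  shows "graph_rank (induced G (S1 \<union> S2)) =
           graph_rank (induced G1 S1) + graph_rank (induced G2 S2)" (is ?rank)
    and "graph_nullity (induced G (S1 \<union> S2)) =
           graph_nullity (induced G1 S1) + graph_nullity (induced G2 S2)" (is ?nullity)
proof -
  let ?M = "adj_matrix (induced G (S1 \<union> S2))"
    and ?M1 = "adj_matrix (induced G1 S1)" and ?M2 = "adj_matrix (induced G2 S2)"
  have disj: "S1 \<inter> S2 = {}"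
    using U S unfolding disjoint_union_def by blast
  have finS: "finite S1" "finite S2"
    using U S fin unfolding disjoint_union_def by (auto intro: finite_subset)
  have vs: "verts G \<inter> (S1 \<union> S2) = S1 \<union> S2" "verts G1 \<inter> S1 = S1" "verts G2 \<inter> S2 = S2"
    using U S unfolding disjoint_union_def by auto
  \<comment> \<open>Edges of each part stay within its own vertices; this makes the off-diagonal
    blocks zero.\<close>
  have edge: "u \<in> verts G1 \<and> v \<in> verts G1" if "{u, v} \<in> edges G1" for u v
  proof -
    have "edges G1 \<subseteq> {{u, v} | u v. u \<in> verts G1 \<and> v \<in> verts G1}"
      using U by (simp add: disjoint_union_def weighted_subgraph_def weighted_graph_def)
    with that have "\<exists>u' v'. {u, v} = {u', v'} \<and> u' \<in> verts G1 \<and> v' \<in> verts G1"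
      by blast
    thus ?thesis
      by (auto simp: doubleton_eq_iff)
  qed
  have edge': "u \<in> verts G2 \<and> v \<in> verts G2" if "{u, v} \<in> edges G2" for u v
  proof -
    have "edges G2 \<subseteq> {{u, v} | u v. u \<in> verts G2 \<and> v \<in> verts G2}"
      using U by (simp add: disjoint_union_def weighted_subgraph_def weighted_graph_def)
    with that have "\<exists>u' v'. {u, v} = {u', v'} \<and> u' \<in> verts G2 \<and> v' \<in> verts G2"
      by blast
    thus ?thesis
      by (auto simp: doubleton_eq_iff)
  qed
  have edges: "edges G = edges G1 \<union> edges G2" "verts G1 \<inter> verts G2 = {}"
    using U by (auto simp: disjoint_union_def)
  have M1: "?M u = ?M1 u" if "u \<in> S1" for u
  proof
    fix v
    show "?M u v = ?M1 u v"
      using that S edges edge[of u v] edge'[of u v]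
      by (auto simp: adj_matrix_def adjacent_induced adjacent_def[of G] adjacent_def[of G1])
  qed
  have M2: "?M u = ?M2 u" if "u \<in> S2" for u
  proof
    fix v
    show "?M u v = ?M2 u v"
      using that S edges edge[of u v] edge'[of u v]
      by (auto simp: adj_matrix_def adjacent_induced adjacent_def[of G] adjacent_def[of G2])
  qed
  have supp1: "?M1 u v = 0" if "v \<notin> S1" for u v
    using that by (simp add: adj_matrix_def adjacent_induced)
  have supp2: "?M2 u v = 0" if "v \<notin> S2" for u v
    using that by (simp add: adj_matrix_def adjacent_induced)
  have span_supp: "f v = 0"
    if "f \<in> gf2.span X" "\<And>g. g \<in> X \<Longrightarrow> g v = 0" for f X and v :: 'a
    using that by (induction rule: gf2.span_induct_alt) (auto simp: gf2_scale_def)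
  have indep: "gf2.span X \<inter> gf2.span Y \<subseteq> {0}"
    if "\<And>g v. g \<in> X \<Longrightarrow> v \<notin> S1 \<Longrightarrow> g v = 0" "\<And>g v. g \<in> Y \<Longrightarrow> v \<notin> S2 \<Longrightarrow> g v = 0" for X Y
  proof clarify
    fix f assume "f \<in> gf2.span X" "f \<in> gf2.span Y"
    hence "f v = 0" for v
      using span_supp[of f X v] span_supp[of f Y v] that disj by blast
    thus "f = 0"
      by (simp add: fun_eq_iff)
  qed
  have "?M ` (S1 \<union> S2) = ?M1 ` S1 \<union> ?M2 ` S2"
    using M1 M2 by (auto simp: image_Un)
  moreover have "gf2.dim (?M1 ` S1 \<union> ?M2 ` S2) = gf2.dim (?M1 ` S1) + gf2.dim (?M2 ` S2)"
    using finS supp1 supp2 by (intro gf2.dim_Un indep) auto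
  ultimately show ?rank
    by (simp add: graph_rank_def vs)
  let ?K = "kernel_on (S1 \<union> S2) ?M" and ?K1 = "kernel_on S1 ?M1" and ?K2 = "kernel_on S2 ?M2"
  have sum1: "(\<Sum>v\<in>S1 \<union> S2. ?M u v * f v) = (\<Sum>v\<in>S1. ?M1 u v * f v)" if "u \<in> S1" for u f
    using that finS supp1 by (intro sum.mono_neutral_cong_right) (auto simp: M1)
  have sum2: "(\<Sum>v\<in>S1 \<union> S2. ?M u v * f v) = (\<Sum>v\<in>S2. ?M2 u v * f v)" if "u \<in> S2" for u f
    using that finS supp2 by (intro sum.mono_neutral_cong_right) (auto simp: M2)
  have K: "f \<in> ?K \<longleftrightarrow> (\<forall>v. v \<notin> S1 \<union> S2 \<longrightarrow> f v = 0) \<and>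
      (\<forall>u\<in>S1. (\<Sum>v\<in>S1. ?M1 u v * f v) = 0) \<and> (\<forall>u\<in>S2. (\<Sum>v\<in>S2. ?M2 u v * f v) = 0)" for f
    using sum1 sum2 by (auto simp: kernel_on_def ball_Un)
  \<comment> \<open>\<open>?K\<close> is the direct sum of \<open>?K1\<close> and
    \<open>?K2\<close>, so it has the same span as their union: a null vector is the sum of its
    restrictions to \<open>S1\<close> and \<open>S2\<close>.\<close>
  have "gf2.dim ?K = gf2.dim (?K1 \<union> ?K2)"
  proof (rule gf2.span_eq_dim, subst gf2.span_eq, intro conjI subsetI)
    fix f assume f: "f \<in> ?K"
    define g where "g v = (if v \<in> S1 then f v else 0)" for v
    define h where "h v = (if v \<in> S2 then f v else 0)" for v
    have "g \<in> ?K1" "h \<in> ?K2"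
      using f unfolding K by (auto simp: kernel_on_def g_def h_def)
    moreover have "f = g + h"
      using f disj unfolding K by (auto simp: g_def h_def fun_eq_iff)
    ultimately show "f \<in> gf2.span (?K1 \<union> ?K2)"
      by (auto intro: gf2.span_add gf2.span_base)
  next
    fix f assume f: "f \<in> ?K1 \<union> ?K2"
    have "f \<in> ?K"
    proof (cases "f \<in> ?K1")
      case True
      hence "(\<Sum>v\<in>S2. ?M2 u v * f v) = 0" for u
        using disj by (intro sum.neutral) (auto simp: kernel_on_def)
      with True show ?thesis
        unfolding K by (auto simp: kernel_on_def)
    next
      case False
      hence *: "f \<in> ?K2"
        using f by simp
      hence "(\<Sum>v\<in>S1. ?M1 u v * f v) = 0" for u
        using disj by (intro sum.neutral) (auto simp: kernel_on_def)
      with * show ?thesis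
        unfolding K by (auto simp: kernel_on_def)
    qed
    thus "f \<in> gf2.span ?K"
      by (rule gf2.span_base)
  qed
  also have "\<dots> = gf2.dim ?K1 + gf2.dim ?K2"
    using finS by (intro gf2.dim_Un indep finite_kernel_on) (auto simp: kernel_on_def)
  finally show ?nullity
    by (simp add: graph_nullity_kernel_on vs)
qed

section \<open>The interlace polynomial\<close>

definition interlace_term :: "'a::comm_ring_1 \<Rightarrow> 'a \<Rightarrow> ('v, 'a) wgraph \<Rightarrow> 'v set \<Rightarrow> 'a" where
  "interlace_term x y G S =
     (\<Prod>s\<in>S. alpha G s) * (\<Prod>v\<in>verts G - S. beta G v) *
     (x - 1) ^ graph_rank (induced G S) * (y - 1) ^ graph_nullity (induced G S)"

lemma interlace_eq_sum: "interlace x y G = (\<Sum>S\<in>Pow (verts G). interlace_term x y G S)"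
  by (simp add: interlace_def interlace_term_def)

text \<open>For \<open>S\<close> avoiding \<open>a\<close>, the vertex \<open>a\<close> contributes
  only the factor \<open>beta G a\<close>, so the subtraction cancels exactly these terms.\<close>

lemma interlace_minus_delete_vertex:
  assumes "finite (verts G)" "a \<in> verts G"
  shows "interlace x y G - beta G a * interlace x y (delete_vertex G a) =
           (\<Sum>S | S \<subseteq> verts G \<and> a \<in> S. interlace_term x y G S)"
proof -
  have term_eq: "beta G a * interlace_term x y (delete_vertex G a) S = interlace_term x y G S"
    if S: "S \<subseteq> verts G - {a}" for S
  proof -
    have "(\<Prod>v\<in>verts G - S. beta G v) = beta G a * (\<Prod>v\<in>verts G - S - {a}. beta G v)"
      using assms S by (intro prod.remove) auto
    moreover have "verts G - S - {a} = verts G - {a} - S"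
      by blast
    ultimately show ?thesis
      using S by (simp add: interlace_term_def induced_delete_vertex mult_ac)
  qed
  have "interlace x y G =
      (\<Sum>S\<in>{S. S \<subseteq> verts G \<and> a \<in> S} \<union> Pow (verts G - {a}). interlace_term x y G S)"
    unfolding interlace_eq_sum by (intro sum.cong) auto
  also have "\<dots> = (\<Sum>S | S \<subseteq> verts G \<and> a \<in> S. interlace_term x y G S) +
      (\<Sum>S\<in>Pow (verts G - {a}). interlace_term x y G S)"
    using assms by (intro sum.union_disjoint) auto
  also have "(\<Sum>S\<in>Pow (verts G - {a}). interlace_term x y G S) =
      beta G a * interlace x y (delete_vertex G a)"
    unfolding interlace_eq_sum sum_distrib_left by (intro sum.cong) (auto simp: term_eq)
  finally show ?thesis
    by simp
qed

section \<open>The three identities for the interlace polynomial\<close>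

lemma interlace_local_complement:
  assumes "finite (verts G)" "a \<in> verts G" "\<not> looped G a"
  shows "interlace x y G - beta G a * interlace x y (delete_vertex G a) =
         interlace x y (local_complement G a)
           - beta G a * interlace x y (delete_vertex (local_complement G a) a)"
proof -
  have "(\<Sum>S | S \<subseteq> verts G \<and> a \<in> S. interlace_term x y G S) =
      (\<Sum>S | S \<subseteq> verts G \<and> a \<in> S. interlace_term x y (local_complement G a) S)"
    using assms
    by (intro sum.cong) (auto simp: interlace_term_def induced_local_complement_rank_nullity)
  thus ?thesis
    using interlace_minus_delete_vertex[of G a x y]
      interlace_minus_delete_vertex[of "local_complement G a" a x y] assms by simp
qed

text \<open>The subtraction formula is applied to both graphs with \<open>a\<close> deleted, at the
  vertex \<open>b\<close>; hence the factor \<open>beta G b\<close>. The surviving sets contain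
  \<open>b\<close> and avoid \<open>a\<close>, as \<open>induced_pivot_rank_nullity\<close>
  demands.\<close>

lemma interlace_pivot:
  assumes "finite (verts G)" "b \<in> verts G" "a \<noteq> b" "\<not> looped G b"
  shows "interlace x y (delete_vertex G a)
           - beta G b * interlace x y (delete_vertex (delete_vertex G a) b) =
         interlace x y (delete_vertex (pivot G a b) a)
           - beta G b * interlace x y (delete_vertex (delete_vertex (pivot G a b) a) b)"
proof -
  have "(\<Sum>S | S \<subseteq> verts G - {a} \<and> b \<in> S. interlace_term x y (delete_vertex G a) S) =
      (\<Sum>S | S \<subseteq> verts G - {a} \<and> b \<in> S. interlace_term x y (delete_vertex (pivot G a b) a) S)"
  proof (intro sum.cong refl)
    fix S assume "S \<in> {S. S \<subseteq> verts G - {a} \<and> b \<in> S}"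
    hence S: "S \<subseteq> verts G - {a}" "b \<in> S" "a \<notin> S" "S \<subseteq> verts G" "finite S"
      using assms(1) finite_subset by auto
    thus "interlace_term x y (delete_vertex G a) S =
        interlace_term x y (delete_vertex (pivot G a b) a) S"
      using induced_pivot_rank_nullity[OF S(5,2,3,4) assms(4)]
      by (simp add: interlace_term_def induced_delete_vertex)
  qed
  thus ?thesis
    using interlace_minus_delete_vertex[of "delete_vertex G a" b x y]
      interlace_minus_delete_vertex[of "delete_vertex (pivot G a b) a" b x y] assms by simp
qed

text \<open>Each vertex set splits uniquely into its traces on the two parts. Weights multiply and
  exponents add, so the sum over pairs factors.\<close>

lemma interlace_disjoint_union:
  assumes U: "disjoint_union G G1 G2" and fin: "finite (verts G)"
  shows "interlace x y G = interlace x y G1 * interlace x y G2"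
proof -
  have V: "verts G = verts G1 \<union> verts G2" "verts G1 \<inter> verts G2 = {}"
    and fin': "finite (verts G1)" "finite (verts G2)"
    using U fin by (auto simp: disjoint_union_def)
  have w: "alpha G v = alpha G1 v \<and> beta G v = beta G1 v" if "v \<in> verts G1" for v
    using U that by (simp add: disjoint_union_def weighted_subgraph_def)
  have w': "alpha G v = alpha G2 v \<and> beta G v = beta G2 v" if "v \<in> verts G2" for v
    using U that by (simp add: disjoint_union_def weighted_subgraph_def)
  have term_eq: "interlace_term x y G (S1 \<union> S2) = interlace_term x y G1 S1 * interlace_term x y G2 S2"
    if S: "S1 \<subseteq> verts G1" "S2 \<subseteq> verts G2" for S1 S2
  proof -
    have "(\<Prod>s\<in>S1 \<union> S2. alpha G s) = (\<Prod>s\<in>S1. alpha G s) * (\<Prod>s\<in>S2. alpha G s)"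
      using S V fin' by (intro prod.union_disjoint) (auto intro: finite_subset)
    also have "\<dots> = (\<Prod>s\<in>S1. alpha G1 s) * (\<Prod>s\<in>S2. alpha G2 s)"
      \<comment> \<open>The weights of \<open>G1\<close> and \<open>G2\<close> agree with those of
        \<open>G\<close> only on their own vertices, so they are exchanged inside each
        product.\<close>
      using S w w' by (intro arg_cong2[of _ _ _ _ "(*)"] prod.cong) auto
    finally have a: "(\<Prod>s\<in>S1 \<union> S2. alpha G s) = \<dots>" .
    have "verts G - (S1 \<union> S2) = (verts G1 - S1) \<union> (verts G2 - S2)"
      using S V by blast
    moreover have "(\<Prod>v\<in>(verts G1 - S1) \<union> (verts G2 - S2). beta G v) =
        (\<Prod>v\<in>verts G1 - S1. beta G v) * (\<Prod>v\<in>verts G2 - S2. beta G v)"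
      using V fin' by (intro prod.union_disjoint) auto
    moreover have "\<dots> = (\<Prod>v\<in>verts G1 - S1. beta G1 v) * (\<Prod>v\<in>verts G2 - S2. beta G2 v)"
      using w w' by (intro arg_cong2[of _ _ _ _ "(*)"] prod.cong) auto
    ultimately show ?thesis
      using a disjoint_union_rank_nullity[OF U fin S]
      by (simp add: interlace_term_def power_add mult_ac)
  qed
  have bij: "bij_betw (\<lambda>(S1, S2). S1 \<union> S2) (Pow (verts G1) \<times> Pow (verts G2)) (Pow (verts G))"
    by (rule bij_betw_byWitness[where f' = "\<lambda>S. (S \<inter> verts G1, S \<inter> verts G2)"])
      (use V in auto)
  have "interlace x y G =
      (\<Sum>(S1, S2)\<in>Pow (verts G1) \<times> Pow (verts G2). interlace_term x y G (S1 \<union> S2))"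
    unfolding interlace_eq_sum sum.reindex_bij_betw[OF bij, symmetric]
    by (simp add: case_prod_unfold)
  also have "\<dots> = (\<Sum>(S1, S2)\<in>Pow (verts G1) \<times> Pow (verts G2).
      interlace_term x y G1 S1 * interlace_term x y G2 S2)"
    by (intro sum.cong) (auto simp: term_eq)
  also have "\<dots> = interlace x y G1 * interlace x y G2"
    by (simp add: interlace_eq_sum sum_product sum.cartesian_product)
  finally show ?thesis .
qed

theorem theorem2:
  fixes G :: "('v, 'a::comm_ring_1) wgraph" and x y :: 'a
  assumes "weighted_graph G"
  shows "(\<forall>a\<in>verts G. \<not> looped G a \<longrightarrow>
            interlace x y G - beta G a * interlace x y (delete_vertex G a) =
            interlace x y (local_complement G a)
              - beta G a * interlace x y (delete_vertex (local_complement G a) a)) \<and>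
         (\<forall>a\<in>verts G. \<forall>b\<in>verts G. a \<noteq> b \<and> adjacent G a b \<and> \<not> looped G a \<and> \<not> looped G b \<longrightarrow>
            interlace x y (delete_vertex G a)
              - beta G b * interlace x y (delete_vertex (delete_vertex G a) b) =
            interlace x y (delete_vertex (pivot G a b) a)
              - beta G b * interlace x y (delete_vertex (delete_vertex (pivot G a b) a) b)) \<and>
         (\<forall>G1 G2. disjoint_union G G1 G2 \<longrightarrow>
            interlace x y G = interlace x y G1 * interlace x y G2)"
proof -
  have fin: "finite (verts G)"
    using assms by (simp add: weighted_graph_def)
  show ?thesis
    by (intro conjI ballI allI impI;
        (rule interlace_local_complement interlace_pivot interlace_disjoint_union)?)
      (use fin in auto)
qed

end
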